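(* Let $0<\alpha<\beta<\infty$ and let $p_1,p_2>0$ with $p_1+p_2=1$. Let $x_n(\omega)$, $n\ge 1$, $\omega\in[0,1]$, be the random points (backward orbit of $1/2$ under the left branches) defined in the context, and set $c_n(\omega):=n^{1/\alpha}x_n(\omega)$ and $c(\alpha):=\frac12\alpha^{-1/\alpha}$. Then for Lebesgue-almost every $\omega\in[0,1]$, $$\lim_{n\to\infty}c_n(\omega)=\tfrac12(\alpha p_1)^{-1/\alpha}=c(\alpha)\,p_1^{-1/\alpha},$$ that is, $x_n(\omega)\sim c(\alpha)p_1^{-1/\alpha}n^{-1/\alpha}$. Moreover, $$E_\omega\bigl(|c_n(\omega)-c(\alpha)p_1^{-1/\alpha}|\bigr)\to 0\quad\text{as } n\to\infty,$$ i.e. the convergence of $n^{1/\alpha}x_n$ to $c(\alpha)p_1^{-1/\alpha}$ also holds in $L^1$-norm.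
   Context: For $0<\gamma<\infty$ let $T_\gamma:[0,1]\to[0,1]$ be $T_\gamma(x)=x(1+2^\gamma x^\gamma)$ for $x\in[0,\frac12]$ and $T_\gamma(x)=2x-1$ for $x\in(\frac12,1]$. Its left branch is a bijection $[0,\frac12]\to[0,1]$; denote its inverse by $(T_\gamma|_{[0,1/2]})^{-1}$. Given $\alpha<\beta$ and $p_1,p_2$, define on $[0,1]$: $a(\omega)=\alpha$ and $\varphi(\omega)=\omega/p_1$ if $\omega\in[0,p_1)$; $a(\omega)=\beta$ and $\varphi(\omega)=(\omega-p_1)/p_2$ if $\omega\in[p_1,1]$. Define $x_1(\omega)\equiv\frac12$ and, for $n\ge2$, $x_n(\omega)=(T_{a(\omega)}|_{[0,1/2]})^{-1}\bigl(x_{n-1}(\varphi\omega)\bigr)$. $E_\omega$ denotes expectation (integral) over $\omega\in[0,1]$ with respect to Lebesgue measure. $a_n\sim b_n$ means $a_n/b_n\to1$. *)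

theory Defs
  imports "HOL-Analysis.Analysis"
begin

definition lsv_map :: "real \<Rightarrow> real \<Rightarrow> real" where
  "lsv_map \<gamma> x = (if x \<le> 1/2 then x * (1 + 2 powr \<gamma> * x powr \<gamma>) else 2 * x - 1)"

definition lsv_left_inv :: "real \<Rightarrow> real \<Rightarrow> real" where
  "lsv_left_inv \<gamma> = the_inv_into {0..1/2} (lsv_map \<gamma>)"

definition rand_param :: "real \<Rightarrow> real \<Rightarrow> real \<Rightarrow> real \<Rightarrow> real" where
  "rand_param \<alpha> \<beta> p\<^sub>1 \<omega> = (if \<omega> < p\<^sub>1 then \<alpha> else \<beta>)"

definition base_map :: "real \<Rightarrow> real \<Rightarrow> real \<Rightarrow> real" where
  "base_map p\<^sub>1 p\<^sub>2 \<omega> = (if \<omega> < p\<^sub>1 then \<omega> / p\<^sub>1 else (\<omega> - p\<^sub>1) / p\<^sub>2)"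

text \<open>The sequence starts at index 1; the value at index 0 is a dummy.\<close>

fun rand_pt :: "real \<Rightarrow> real \<Rightarrow> real \<Rightarrow> real \<Rightarrow> nat \<Rightarrow> real \<Rightarrow> real" where
  "rand_pt \<alpha> \<beta> p\<^sub>1 p\<^sub>2 0 \<omega> = 1/2"
| "rand_pt \<alpha> \<beta> p\<^sub>1 p\<^sub>2 (Suc 0) \<omega> = 1/2"
| "rand_pt \<alpha> \<beta> p\<^sub>1 p\<^sub>2 (Suc (Suc n)) \<omega> =
     lsv_left_inv (rand_param \<alpha> \<beta> p\<^sub>1 \<omega>) (rand_pt \<alpha> \<beta> p\<^sub>1 p\<^sub>2 (Suc n) (base_map p\<^sub>1 p\<^sub>2 \<omega>))"

definition scaled_pt :: "real \<Rightarrow> real \<Rightarrow> real \<Rightarrow> real \<Rightarrow> nat \<Rightarrow> real \<Rightarrow> real" where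
  "scaled_pt \<alpha> \<beta> p\<^sub>1 p\<^sub>2 n \<omega> = real n powr (1/\<alpha>) * rand_pt \<alpha> \<beta> p\<^sub>1 p\<^sub>2 n \<omega>"

definition asymp_const :: "real \<Rightarrow> real" where
  "asymp_const \<alpha> = 1/2 * \<alpha> powr (-1/\<alpha>)"

end

theory Submission
  imports Defs "HOL-Real_Asymp.Real_Asymp"
begin

text \<open>
  Put \<open>y = 2x\<close> and \<open>z = y\<close> to the power \<open>-\<alpha>\<close>. Every application of a left inverse branch increases \<open>z\<close>: as
  \<open>y\<close> tends to 0, by an amount tending to \<open>\<alpha>\<close> for the branch with parameter \<open>\<alpha>\<close> and to 0 for the one with
  parameter \<open>\<beta>\<close>. Since the pure \<open>\<beta>\<close>-orbit is the slowest, \<open>y\<close> tends to 0 uniformly in \<open>\<omega>\<close>, so \<open>z\<close>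
  equals \<open>\<alpha>\<close> times the number of \<open>\<alpha>\<close>-steps up to an error that is \<open>o(n)\<close> uniformly in \<open>\<omega>\<close>. A Chernoff
  bound for that number and the Borel-Cantelli lemma give the almost sure limit. For the convergence in
  mean, \<open>c_n\<close> is bounded except on a set of exponentially small measure, where it grows at most
  polynomially in \<open>n\<close>.
\<close>

section \<open>Inverse of the left branch\<close>

text \<open>The left branch increases strictly and continuously from 0 to 1, so by the intermediate
  value theorem \<open>the_inv_into\<close> is a genuine inverse. Doubling the point inside the
  power absorbs the factor \<open>2 powr \<gamma>\<close> and prepares the coordinate
  \<open>y\<close>.\<close>

lemma lsv_left_inv:
  fixes \<gamma> x :: real
  assumes "0 < \<gamma>" "0 < x" "x \<le> 1"
  shows "0 < lsv_left_inv \<gamma> x" "lsv_left_inv \<gamma> x \<le> 1/2"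
    "lsv_left_inv \<gamma> x * (1 + (2 * lsv_left_inv \<gamma> x) powr \<gamma>) = x"
proof -
  let ?f = "\<lambda>u::real. u * (1 + 2 powr \<gamma> * u powr \<gamma>)"
  have eq: "lsv_map \<gamma> u = ?f u" if "u \<in> {0..1/2}" for u
    using that by (simp add: lsv_map_def)
  have mono: "lsv_map \<gamma> u < lsv_map \<gamma> v" if "u \<in> {0..1/2}" "v \<in> {0..1/2}" "u < v" for u v
  proof -
    have "u powr \<gamma> \<le> v powr \<gamma>"
      using that assms by (intro powr_mono2) auto
    then have "?f u \<le> u * (1 + 2 powr \<gamma> * v powr \<gamma>)"
      using that by (intro mult_left_mono) auto
    also have "\<dots> < ?f v"
      using that by (intro mult_strict_right_mono) (auto intro: add_pos_nonneg)
    finally show ?thesis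
      using that eq by simp
  qed
  have inj: "inj_on (lsv_map \<gamma>) {0..1/2}"
    by (rule linorder_inj_onI') (use mono in force)
  have "continuous_on {0..1/2} ?f"
    using assms by (intro continuous_intros continuous_on_powr') auto
  moreover have "?f 0 = 0" "?f (1/2) = 1"
    using assms by (simp_all add: powr_mult [symmetric])
  ultimately obtain u where "0 \<le> u" "u \<le> 1/2" "?f u = x"
    using IVT' [of ?f 0 x "1/2"] assms by auto
  then have "x \<in> lsv_map \<gamma> ` {0..1/2}"
    using eq by force
  then have "lsv_left_inv \<gamma> x \<in> {0..1/2}" "lsv_map \<gamma> (lsv_left_inv \<gamma> x) = x"
    unfolding lsv_left_inv_def
    using inj the_inv_into_into f_the_inv_into_f by (metis order_refl)+
  moreover from this have "lsv_left_inv \<gamma> x \<noteq> 0"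
    using assms by (auto simp: lsv_map_def)
  ultimately show "0 < lsv_left_inv \<gamma> x" "lsv_left_inv \<gamma> x \<le> 1/2"
    "lsv_left_inv \<gamma> x * (1 + (2 * lsv_left_inv \<gamma> x) powr \<gamma>) = x"
    using eq by (auto simp: powr_mult)
qed

section \<open>Gain of \<open>z\<close> in one step\<close>

text \<open>Increment of \<open>z\<close> under the inverse branch with parameter \<gamma>, taken as
  a function of the new point \<open>w\<close>: the old point
  \<open>w * (1 + w powr \<gamma>)\<close> is explicit in \<open>w\<close>, while the new one is
  only implicit in the old.\<close>

definition step_gain :: "real \<Rightarrow> real \<Rightarrow> real \<Rightarrow> real" where
  "step_gain \<alpha> \<gamma> w = w powr (-\<alpha>) * (1 - (1 + w powr \<gamma>) powr (-\<alpha>))"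

lemma powr_minus_eq_add_step_gain:
  assumes "0 < w"
  shows "w powr (-\<alpha>) = (w * (1 + w powr \<gamma>)) powr (-\<alpha>) + step_gain \<alpha> \<gamma> w"
  using assms by (simp add: step_gain_def powr_mult right_diff_distrib)

lemma step_gain_nonneg:
  assumes "0 < \<alpha>"
  shows "0 \<le> step_gain \<alpha> \<gamma> w"
proof -
  have "(1 + w powr \<gamma>) powr (-\<alpha>) \<le> 1 powr (-\<alpha>)"
    using assms by (intro powr_mono2') auto
  then show ?thesis
    by (simp add: step_gain_def)
qed

text \<open>With \<open>t = w powr \<gamma>\<close>, the inequalities
  \<open>ln (1 + t) \<le> t\<close> and \<open>1 + u \<le> exp u\<close> give the Bernoulli-type
  bound \<open>1 - \<alpha> * t \<le> (1 + t) powr (-\<alpha>)\<close>.\<close>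

lemma step_gain_le:
  assumes "0 < \<alpha>" "0 < w"
  shows "step_gain \<alpha> \<gamma> w \<le> \<alpha> * w powr (\<gamma> - \<alpha>)"
proof -
  let ?t = "w powr \<gamma>"
  have t: "0 < 1 + ?t"
    by (simp add: add_pos_nonneg)
  have "1 - \<alpha> * ?t \<le> 1 - \<alpha> * ln (1 + ?t)"
    using assms ln_add_one_self_le_self [of ?t] by simp
  also have "\<dots> \<le> exp (- \<alpha> * ln (1 + ?t))"
    using exp_ge_add_one_self [of "- \<alpha> * ln (1 + ?t)"] by simp
  also have "\<dots> = (1 + ?t) powr (-\<alpha>)"
    using t by (simp add: powr_def)
  finally have "1 - (1 + ?t) powr (-\<alpha>) \<le> \<alpha> * ?t"
    by simp
  then have "step_gain \<alpha> \<gamma> w \<le> w powr (-\<alpha>) * (\<alpha> * ?t)"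
    unfolding step_gain_def by (intro mult_left_mono) auto
  also have "\<dots> = \<alpha> * w powr (\<gamma> - \<alpha>)"
    by (simp add: powr_diff powr_minus field_simps)
  finally show ?thesis .
qed

text \<open>With \<open>t = w powr \<alpha>\<close>, the gain is minus the difference quotient at 0
  of \<open>(1 + t) powr (-\<alpha>)\<close>, whose derivative there is -\<alpha>.\<close>

lemma step_gain_self_tendsto:
  assumes "0 < \<alpha>"
  shows "(step_gain \<alpha> \<alpha> \<longlongrightarrow> \<alpha>) (at_right 0)"
proof -
  have "((\<lambda>t. (1 + t) powr (-\<alpha>)) has_real_derivative -\<alpha>) (at 0)"
    by (auto intro!: derivative_eq_intros)
  then have "((\<lambda>t. ((1 + t) powr (-\<alpha>) - 1) / t) \<longlongrightarrow> -\<alpha>) (at 0)"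
    by (simp add: DERIV_def)
  moreover have "filterlim (\<lambda>w. w powr \<alpha>) (at 0) (at_right (0::real))"
  proof (subst filterlim_at, intro conjI)
    show "((\<lambda>w. w powr \<alpha>) \<longlongrightarrow> 0) (at_right (0::real))"
      using assms by (intro tendsto_zero_powrI) (auto simp: eventually_at_right_less
        intro!: eventually_mono [OF eventually_at_right_less])
  qed (auto intro!: eventually_mono [OF eventually_at_right_less])
  ultimately have "((\<lambda>w. ((1 + w powr \<alpha>) powr (-\<alpha>) - 1) / w powr \<alpha>) \<longlongrightarrow> -\<alpha>) (at_right 0)"
    by (rule filterlim_compose)
  from tendsto_minus [OF this] show ?thesis
    by (simp add: step_gain_def [abs_def] powr_minus divide_inverse algebra_simps)
qed

lemma step_gain_greater_tendsto:
  assumes "0 < \<alpha>" "\<alpha> < \<beta>"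
  shows "(step_gain \<alpha> \<beta> \<longlongrightarrow> 0) (at_right 0)"
proof (rule tendsto_sandwich [OF _ _ tendsto_const])
  show "((\<lambda>w. \<alpha> * w powr (\<beta> - \<alpha>)) \<longlongrightarrow> 0) (at_right (0::real))"
    using assms by (intro tendsto_mult_right_zero tendsto_zero_powrI [OF tendsto_ident_at tendsto_const])
      (auto intro!: eventually_mono [OF eventually_at_right_less])
qed (use assms step_gain_nonneg step_gain_le in
    \<open>auto intro!: eventually_mono [OF eventually_at_right_less]\<close>)

section \<open>Counting the \<alpha>-steps\<close>

text \<open>Peels off the first digit of \<omega> exactly as \<open>rand_pt\<close> does, so that
  one induction over \<open>n\<close> with \<omega> arbitrary handles both.\<close>

fun left_visits :: "real \<Rightarrow> real \<Rightarrow> nat \<Rightarrow> real \<Rightarrow> nat" where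
  "left_visits p\<^sub>1 p\<^sub>2 0 \<omega> = 0"
| "left_visits p\<^sub>1 p\<^sub>2 (Suc n) \<omega> =
     (if \<omega> < p\<^sub>1 then 1 else 0) + left_visits p\<^sub>1 p\<^sub>2 n (base_map p\<^sub>1 p\<^sub>2 \<omega>)"

lemma measurable_base_map [measurable]: "base_map p\<^sub>1 p\<^sub>2 \<in> borel_measurable borel"
  unfolding base_map_def [abs_def] by measurable

lemma measurable_left_visits [measurable]:
  "left_visits p\<^sub>1 p\<^sub>2 n \<in> borel \<rightarrow>\<^sub>M count_space UNIV"
proof (induction n)
  case (Suc n)
  note [measurable] = Suc
  show ?case
    unfolding left_visits.simps(2) [abs_def] by measurable
qed simp

text \<open>Dropping the null point 1 leaves the half-open interval, whose pieces below and above
  \<open>p\<^sub>1\<close> are each mapped by \<open>base_map\<close> affinely onto all of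
  it.\<close>

lemma AE_lebesgue_on_unit_intervalI:
  assumes "AE \<omega> in lborel. \<omega> \<in> {0..<1} \<longrightarrow> P \<omega>"
  shows "AE \<omega> in lebesgue_on {0..1::real}. P \<omega>"
proof -
  have "AE \<omega> in lborel. \<omega> \<in> {0..1} \<longrightarrow> P \<omega>"
    using assms AE_lborel_singleton [of 1] by eventually_elim (auto simp: less_le)
  then show ?thesis
    by (subst AE_restrict_space_iff) (auto intro: AE_completion)
qed

section \<open>Orbit estimates uniform in \<omega>\<close>

locale random_lsv =
  fixes \<alpha> \<beta> p\<^sub>1 p\<^sub>2 :: real
  assumes params: "0 < \<alpha>" "\<alpha> < \<beta>" "p\<^sub>1 > 0" "p\<^sub>2 > 0" "p\<^sub>1 + p\<^sub>2 = 1"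
begin

abbreviation "visits \<equiv> left_visits p\<^sub>1 p\<^sub>2"
abbreviation "\<phi> \<equiv> base_map p\<^sub>1 p\<^sub>2"
abbreviation "par \<equiv> rand_param \<alpha> \<beta> p\<^sub>1"
text \<open>The shift by one skips the dummy at index 0, so \<open>y n\<close> results from exactly \<open>n\<close> inverse branches.\<close>

abbreviation "y n \<omega> \<equiv> 2 * rand_pt \<alpha> \<beta> p\<^sub>1 p\<^sub>2 (Suc n) \<omega>"

lemma par_pos: "0 < par \<omega>" and par_ge: "\<alpha> \<le> par \<omega>" and par_le: "par \<omega> \<le> \<beta>"
  using params by (auto simp: rand_param_def)

lemma y_bounds: "0 < y n \<omega>" "y n \<omega> \<le> 1"
proof -
  have "0 < y n \<omega> \<and> y n \<omega> \<le> 1"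
  proof (induction n arbitrary: \<omega>)
    case (Suc n)
    then show ?case
      using lsv_left_inv [OF par_pos, of "rand_pt \<alpha> \<beta> p\<^sub>1 p\<^sub>2 (Suc n) (\<phi> \<omega>)" \<omega>] Suc [of "\<phi> \<omega>"]
      by auto
  qed auto
  then show "0 < y n \<omega>" "y n \<omega> \<le> 1"
    by auto
qed

lemma y_Suc: "y (Suc n) \<omega> * (1 + y (Suc n) \<omega> powr par \<omega>) = y n (\<phi> \<omega>)"
  using lsv_left_inv(3) [OF par_pos, of "rand_pt \<alpha> \<beta> p\<^sub>1 p\<^sub>2 (Suc n) (\<phi> \<omega>)" \<omega>] y_bounds [of n "\<phi> \<omega>"]
  by auto

lemma y_powr_Suc:
  "y (Suc n) \<omega> powr (-\<alpha>) = y n (\<phi> \<omega>) powr (-\<alpha>) + step_gain \<alpha> (par \<omega>) (y (Suc n) \<omega>)"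
  using powr_minus_eq_add_step_gain [OF y_bounds(1)] y_Suc by metis

text \<open>While \<open>y\<close> stays above \<open>\<delta>\<close>, each inverse branch contracts it at least by the factor occurring here.\<close>

lemma y_le_max_power:
  assumes "0 < \<delta>"
  shows "y n \<omega> \<le> max \<delta> (inverse (1 + \<delta> powr \<beta>) ^ n)"
proof (induction n arbitrary: \<omega>)
  case (Suc n)
  let ?w = "y (Suc n) \<omega>" and ?r = "inverse (1 + \<delta> powr \<beta>)"
  have r: "0 < 1 + \<delta> powr \<beta>"
    by (simp add: add_pos_nonneg)
  have w: "0 < ?w" "?w \<le> 1"
    by (rule y_bounds)+
  show ?case
  proof (cases "?w \<le> \<delta>")
    case False
    have "\<delta> powr \<beta> \<le> ?w powr \<beta>"
      using False assms params by (intro powr_mono2) auto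
    \<comment> \<open>As \<open>?w \<le> 1\<close>, the largest exponent \<beta> gives the smallest
      power, hence the weakest contraction.\<close>
    also have "\<dots> \<le> ?w powr par \<omega>"
      using w par_le by (intro powr_mono') auto
    finally have "?w * (1 + \<delta> powr \<beta>) \<le> y n (\<phi> \<omega>)"
      unfolding y_Suc [symmetric] using w by (intro mult_left_mono) auto
    moreover have "?w \<le> ?w * (1 + \<delta> powr \<beta>)"
      using w by (simp add: algebra_simps)
    \<comment> \<open>The earlier point is at least \<open>?w\<close> and so also exceeds \<delta>;
      in the induction hypothesis the maximum must be the power.\<close>
    ultimately have "y n (\<phi> \<omega>) \<le> ?r ^ n"
      using Suc [of "\<phi> \<omega>"] False by auto
    with \<open>?w * (1 + \<delta> powr \<beta>) \<le> _\<close> have "?w * (1 + \<delta> powr \<beta>) \<le> ?r ^ n"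
      by (rule order_trans)
    then have "?w \<le> ?r ^ n / (1 + \<delta> powr \<beta>)"
      using r by (simp only: pos_le_divide_eq)
    then have "?w \<le> ?r ^ Suc n"
      by (simp only: divide_inverse power_Suc mult.commute)
    then show ?thesis
      by simp
  qed auto
qed simp

text \<open>The bound in \<open>y_le_max_power\<close> does not involve \<omega>, so one
  \<open>K\<close> serves every \<omega>.\<close>

lemma y_uniformly_small:
  assumes "0 < \<delta>"
  obtains K where "\<And>n \<omega>. K \<le> n \<Longrightarrow> y n \<omega> \<le> \<delta>"
proof -
  let ?r = "inverse (1 + \<delta> powr \<beta>)"
  have "1 < 1 + \<delta> powr \<beta>"
    using assms by simp
  then have "?r < 1"
    by (subst inverse_less_1_iff) simp
  moreover have "0 \<le> ?r"
    by simp
  ultimately have "(\<lambda>n. ?r ^ n) \<longlonglongrightarrow> 0"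
    by (intro LIMSEQ_power_zero) auto
  then have "\<forall>\<^sub>F n in sequentially. ?r ^ n < \<delta>"
    using assms by (rule order_tendstoD)
  then obtain K where "\<And>n. K \<le> n \<Longrightarrow> ?r ^ n < \<delta>"
    by (auto simp: eventually_sequentially)
  then show ?thesis
    using y_le_max_power [OF assms] that by (smt (verit) max_def)
qed

lemma step_gain_deviation:
  assumes "0 < \<epsilon>"
  obtains K where "\<And>n \<omega>. K \<le> n \<Longrightarrow>
    \<bar>step_gain \<alpha> (par \<omega>) (y n \<omega>) - \<alpha> * of_bool (\<omega> < p\<^sub>1)\<bar> \<le> \<epsilon>"
proof -
  have "\<forall>\<^sub>F w in at_right 0. \<bar>step_gain \<alpha> \<alpha> w - \<alpha>\<bar> < \<epsilon> \<and> \<bar>step_gain \<alpha> \<beta> w\<bar> < \<epsilon>"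
    using tendstoD [OF step_gain_self_tendsto [OF params(1)] assms] tendstoD [OF step_gain_greater_tendsto [OF params(1,2)] assms]
      by eventually_elim (simp add: dist_real_def)
  then obtain \<delta> where \<delta>: "0 < \<delta>"
    "\<And>w. 0 < w \<Longrightarrow> w < \<delta> \<Longrightarrow> \<bar>step_gain \<alpha> \<alpha> w - \<alpha>\<bar> < \<epsilon> \<and> \<bar>step_gain \<alpha> \<beta> w\<bar> < \<epsilon>"
    by (auto simp: eventually_at_right_field)
  obtain K where K: "\<And>n \<omega>. K \<le> n \<Longrightarrow> y n \<omega> \<le> \<delta> / 2"
    using y_uniformly_small [of "\<delta> / 2"] \<delta>(1) by auto
  show ?thesis
  proof (rule that)
    fix n \<omega> assume "K \<le> n"
    then have "y n \<omega> < \<delta>"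
      using K [of n \<omega>] \<delta>(1) by simp
    then show "\<bar>step_gain \<alpha> (par \<omega>) (y n \<omega>) - \<alpha> * of_bool (\<omega> < p\<^sub>1)\<bar> \<le> \<epsilon>"
      using \<delta>(2) [OF y_bounds(1), of n \<omega>] by (auto simp: rand_param_def)
  qed
qed

text \<open>Both terms of the difference lie between 0 and \<alpha>, because
  \<open>y n \<omega> \<le> 1\<close> and the parameter is at least \<alpha>. This crude bound
  covers the initial steps, where \<open>y\<close> need not be small.\<close>

lemma step_gain_deviation_le:
  "\<bar>step_gain \<alpha> (par \<omega>) (y n \<omega>) - \<alpha> * of_bool (\<omega> < p\<^sub>1)\<bar> \<le> \<alpha>"
proof -
  have "y n \<omega> powr (par \<omega> - \<alpha>) \<le> 1"
    using y_bounds [of n \<omega>] par_ge [of \<omega>] by (intro powr_le1) auto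
  then have "\<alpha> * y n \<omega> powr (par \<omega> - \<alpha>) \<le> \<alpha>"
    using params by (simp add: mult_left_le)
  then have "step_gain \<alpha> (par \<omega>) (y n \<omega>) \<le> \<alpha>"
    using step_gain_le [OF params(1) y_bounds(1)] order_trans by blast
  moreover have "0 \<le> step_gain \<alpha> (par \<omega>) (y n \<omega>)"
    using params by (intro step_gain_nonneg) auto
  ultimately show ?thesis
    by auto
qed

lemma y_powr_approx:
  assumes "0 < \<epsilon>"
  obtains M where "\<And>n \<omega>. \<bar>y n \<omega> powr (-\<alpha>) - \<alpha> * real (visits n \<omega>)\<bar> \<le> M + \<epsilon> * real n"
proof -
  obtain K where K: "\<And>n \<omega>. K \<le> n \<Longrightarrow>
    \<bar>step_gain \<alpha> (par \<omega>) (y n \<omega>) - \<alpha> * of_bool (\<omega> < p\<^sub>1)\<bar> \<le> \<epsilon>"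
    using step_gain_deviation assms by metis
  \<comment> \<open>The summand 1 is the value at \<open>n = 0\<close>; each of the first
    \<open>K\<close> steps is allowed an error \<alpha>, and every step an error \<epsilon>.\<close>
  have "\<bar>y n \<omega> powr (-\<alpha>) - \<alpha> * real (visits n \<omega>)\<bar> \<le> 1 + \<alpha> * real (min n K) + \<epsilon> * real n" for n \<omega>
  proof (induction n arbitrary: \<omega>)
    case (Suc n)
    let ?d = "step_gain \<alpha> (par \<omega>) (y (Suc n) \<omega>) - \<alpha> * of_bool (\<omega> < p\<^sub>1)"
    have eq: "y (Suc n) \<omega> powr (-\<alpha>) - \<alpha> * real (visits (Suc n) \<omega>) =
       y n (\<phi> \<omega>) powr (-\<alpha>) - \<alpha> * real (visits n (\<phi> \<omega>)) + ?d"
      unfolding y_powr_Suc by (simp add: algebra_simps)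
    have "\<bar>?d\<bar> \<le> \<alpha> * (real (min (Suc n) K) - real (min n K)) + \<epsilon>"
    proof (cases "K \<le> Suc n")
      case True
      have "0 \<le> \<alpha> * (real (min (Suc n) K) - real (min n K))"
        using params by (intro mult_nonneg_nonneg) auto
      then show ?thesis
        using K [OF True, of \<omega>] by simp
    next
      case False
      then show ?thesis
        using step_gain_deviation_le [of \<omega> "Suc n"] assms by (simp add: min_def)
    qed
    with Suc [of "\<phi> \<omega>"] show ?case
      unfolding eq by (simp add: algebra_simps)
  qed simp
  moreover have "\<alpha> * real (min n K) \<le> \<alpha> * real K" for n
    using params by (intro mult_left_mono) auto
  ultimately show ?thesis
    using that [of "1 + \<alpha> * real K"] by (smt (verit))
qed

section \<open>Measurability\<close>

text \<open>The point depends only on finitely many binary digits, hence takes finitely many values.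
  Measurability into the discrete space therefore holds, and it survives composition with the
  arbitrary function \<open>lsv_left_inv \<gamma>\<close>.\<close>

lemma measurable_rand_pt: "rand_pt \<alpha> \<beta> p\<^sub>1 p\<^sub>2 (Suc n) \<in> borel \<rightarrow>\<^sub>M count_space UNIV"
proof (induction n)
  case (Suc n)
  have "(\<lambda>\<omega>. rand_pt \<alpha> \<beta> p\<^sub>1 p\<^sub>2 (Suc n) (\<phi> \<omega>)) \<in> borel \<rightarrow>\<^sub>M count_space UNIV"
    by (rule measurable_compose [OF measurable_base_map Suc])
  then have "(\<lambda>\<omega>. lsv_left_inv \<gamma> (rand_pt \<alpha> \<beta> p\<^sub>1 p\<^sub>2 (Suc n) (\<phi> \<omega>))) \<in> borel \<rightarrow>\<^sub>M count_space UNIV" for \<gamma>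
    by (rule measurable_compose) simp
  note [measurable] = this
  have "(\<lambda>\<omega>. if \<omega> < p\<^sub>1 then lsv_left_inv \<alpha> (rand_pt \<alpha> \<beta> p\<^sub>1 p\<^sub>2 (Suc n) (\<phi> \<omega>))
      else lsv_left_inv \<beta> (rand_pt \<alpha> \<beta> p\<^sub>1 p\<^sub>2 (Suc n) (\<phi> \<omega>))) \<in> borel \<rightarrow>\<^sub>M count_space UNIV"
    by measurable
  then show ?case
    by (rule back_subst [where P = "\<lambda>f. f \<in> _"]) (auto simp: rand_param_def)
qed simp

lemma borel_measurable_scaled_pt [measurable]:
  "scaled_pt \<alpha> \<beta> p\<^sub>1 p\<^sub>2 (Suc n) \<in> borel_measurable borel"
  unfolding scaled_pt_def [abs_def]
  by (rule measurable_compose [OF measurable_rand_pt]) simp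

section \<open>Chernoff bound and law of large numbers for the visits\<close>

text \<open>This is the generating function of the binomial distribution. Each further digit
  contributes a factor \<open>p\<^sub>1 * s + p\<^sub>2\<close>, since both branches of
  \<open>base_map\<close> are affine and onto.\<close>

lemma nn_integral_power_visits:
  assumes "0 \<le> s"
  shows "(\<integral>\<^sup>+\<omega>. ennreal (s ^ visits n \<omega>) * indicator {0..<1} \<omega> \<partial>lborel) = ennreal ((p\<^sub>1 * s + p\<^sub>2) ^ n)"
proof (induction n)
  case (Suc n)
  define f :: "real \<Rightarrow> ennreal" where "f = (\<lambda>\<omega>. ennreal (s ^ visits n \<omega>) * indicator {0..<1} \<omega>)"
  have [measurable]: "f \<in> borel_measurable borel"
    unfolding f_def by measurable
  have "0 / p\<^sub>1 \<le> \<omega> / p\<^sub>1 \<longleftrightarrow> 0 \<le> \<omega>" "\<omega> / p\<^sub>1 < 1 \<longleftrightarrow> \<omega> < p\<^sub>1"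
    "0 \<le> (\<omega> - p\<^sub>1) / p\<^sub>2 \<longleftrightarrow> p\<^sub>1 \<le> \<omega>" "(\<omega> - p\<^sub>1) / p\<^sub>2 < 1 \<longleftrightarrow> \<omega> < 1" for \<omega>
    using params by (auto simp: field_simps)
  \<comment> \<open>As \<open>f\<close> vanishes off the half-open unit interval, its two rescaled
    copies live on the domains of the two branches.\<close>
  then have split: "ennreal (s ^ visits (Suc n) \<omega>) * indicator {0..<1} \<omega> =
      ennreal s * f (\<omega> / p\<^sub>1) + f ((\<omega> - p\<^sub>1) / p\<^sub>2)" for \<omega>
    using params assms
    by (auto simp: f_def base_map_def indicator_def ennreal_mult)
  have "(\<integral>\<^sup>+\<omega>. f \<omega> \<partial>lborel) = ennreal (1/p\<^sub>1) * (\<integral>\<^sup>+\<omega>. f (\<omega> / p\<^sub>1) \<partial>lborel)"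
    using nn_integral_real_affine [of f "1/p\<^sub>1" 0] params by simp
  then have "ennreal p\<^sub>1 * (\<integral>\<^sup>+\<omega>. f \<omega> \<partial>lborel) = (\<integral>\<^sup>+\<omega>. f (\<omega> / p\<^sub>1) \<partial>lborel)"
    using params by (simp add: mult.assoc [symmetric] ennreal_mult [symmetric])
  moreover have "(\<integral>\<^sup>+\<omega>. f \<omega> \<partial>lborel) = ennreal (1/p\<^sub>2) * (\<integral>\<^sup>+\<omega>. f ((\<omega> - p\<^sub>1) / p\<^sub>2) \<partial>lborel)"
    using nn_integral_real_affine [of f "1/p\<^sub>2" "-p\<^sub>1/p\<^sub>2"] params
    by (simp add: diff_divide_distrib)
  then have "ennreal p\<^sub>2 * (\<integral>\<^sup>+\<omega>. f \<omega> \<partial>lborel) = (\<integral>\<^sup>+\<omega>. f ((\<omega> - p\<^sub>1) / p\<^sub>2) \<partial>lborel)"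
    using params by (simp add: mult.assoc [symmetric] ennreal_mult [symmetric])
  moreover have "(\<integral>\<^sup>+\<omega>. f \<omega> \<partial>lborel) = ennreal ((p\<^sub>1 * s + p\<^sub>2) ^ n)"
    using Suc by (simp add: f_def)
  ultimately have "(\<integral>\<^sup>+\<omega>. ennreal s * f (\<omega> / p\<^sub>1) + f ((\<omega> - p\<^sub>1) / p\<^sub>2) \<partial>lborel) =
     ennreal s * (ennreal p\<^sub>1 * ennreal ((p\<^sub>1 * s + p\<^sub>2) ^ n)) + ennreal p\<^sub>2 * ennreal ((p\<^sub>1 * s + p\<^sub>2) ^ n)"
    by (simp add: nn_integral_add nn_integral_cmult)
  also have "\<dots> = ennreal (s * (p\<^sub>1 * (p\<^sub>1 * s + p\<^sub>2) ^ n) + p\<^sub>2 * (p\<^sub>1 * s + p\<^sub>2) ^ n)"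
    using assms params by (simp add: ennreal_mult ennreal_plus)
  also have "s * (p\<^sub>1 * (p\<^sub>1 * s + p\<^sub>2) ^ n) + p\<^sub>2 * (p\<^sub>1 * s + p\<^sub>2) ^ n = (p\<^sub>1 * s + p\<^sub>2) ^ Suc n"
    by (simp add: algebra_simps)
  finally show ?case
    unfolding split .
qed simp

text \<open>The two sides of the last inequality agree at \<open>s = 1\<close> and have different derivatives there.\<close>

lemma exists_tilt:
  assumes "q \<noteq> p\<^sub>1"
  obtains s where "0 < s" "0 < (s - 1) * (q - p\<^sub>1)" "p\<^sub>1 * s + p\<^sub>2 < s powr q"
proof -
  define h where "h = (\<lambda>s. p\<^sub>1 * s + p\<^sub>2 - s powr q)"
  have deriv: "(h has_real_derivative p\<^sub>1 - q) (at 1)"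
    unfolding h_def by (auto intro!: derivative_eq_intros)
  have h1: "h 1 = 0"
    using params by (simp add: h_def)
  show ?thesis
  proof (cases "p\<^sub>1 < q")
    case True
    then obtain d where d: "0 < d" "\<And>\<epsilon>. 0 < \<epsilon> \<Longrightarrow> \<epsilon> < d \<Longrightarrow> h (1 + \<epsilon>) < h 1"
      using DERIV_neg_dec_right [OF deriv] by auto
    then show ?thesis
      using that [of "1 + d / 2"] True h1 d(2) [of "d / 2"] by (auto simp: h_def)
  next
    case False
    then obtain d where d: "0 < d" "\<And>\<epsilon>. 0 < \<epsilon> \<Longrightarrow> \<epsilon> < d \<Longrightarrow> h (1 - \<epsilon>) < h 1"
      using DERIV_pos_inc_left [OF deriv] assms by auto
    \<comment> \<open>Less than \<open>d\<close>, so that \<open>h\<close> is below its value at 1,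
      and less than 1, so that \<open>s = 1 - \<epsilon>\<close> is positive.\<close>
    define \<epsilon> where "\<epsilon> = min d 1 / 2"
    have "0 < \<epsilon>" "\<epsilon> < d" "\<epsilon> < 1"
      using d by (auto simp: \<epsilon>_def)
    moreover from this have "\<epsilon> * (q - p\<^sub>1) < 0"
      using False assms by (intro mult_pos_neg) auto
    ultimately show ?thesis
      using that [of "1 - \<epsilon>"] False assms h1 d(2) [of \<epsilon>] by (auto simp: h_def)
  qed
qed

text \<open>One definition for both tails: the lower one if \<open>q < p\<^sub>1\<close>, the upper one if \<open>q > p\<^sub>1\<close>.\<close>

definition deviant :: "real \<Rightarrow> nat \<Rightarrow> real set" where
  "deviant q n = {\<omega> \<in> {0..<1}. 0 \<le> (q - p\<^sub>1) * (real (visits n \<omega>) - q * real n)}"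

lemma measurable_deviant [measurable]: "deviant q n \<in> sets borel"
  unfolding deviant_def by measurable

text \<open>Exponential Markov inequality: \<open>s - 1\<close> has the sign of
  \<open>q - p\<^sub>1\<close>, so on the deviant set \<open>s\<close> to the power
  \<open>visits n \<omega> - q * n\<close> is at least 1, for either tail.\<close>

lemma emeasure_deviant_le:
  assumes "q \<noteq> p\<^sub>1"
  obtains r where "0 < r" "r < 1" "\<And>n. emeasure lborel (deviant q n) \<le> ennreal (r ^ n)"
proof -
  obtain s where s: "0 < s" "0 < (s - 1) * (q - p\<^sub>1)" "p\<^sub>1 * s + p\<^sub>2 < s powr q"
    using exists_tilt [OF assms] by blast
  \<comment> \<open>The one-digit factor of the integral of that power; \<open>r < 1\<close> is
    precisely the last property of \<open>s\<close>.\<close>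
  define r where "r = s powr (-q) * (p\<^sub>1 * s + p\<^sub>2)"
  have pos: "0 < p\<^sub>1 * s + p\<^sub>2"
    using s params by (simp add: add_pos_pos)
  have "emeasure lborel (deviant q n) \<le> ennreal (r ^ n)" for n
  proof -
    have "deviant q n \<subseteq> {\<omega> \<in> {0..<1}. 1 \<le> ennreal ((s powr (-q)) ^ n) * ennreal (s ^ visits n \<omega>)}"
    proof
      fix \<omega> assume \<omega>: "\<omega> \<in> deviant q n"
      let ?t = "real (visits n \<omega>) - q * real n"
      have "1 \<le> s powr ?t"
      proof (cases "1 < s")
        case True
        then have "0 \<le> ?t"
          using \<omega> s by (auto simp: deviant_def zero_le_mult_iff zero_less_mult_iff)
        then show ?thesis
          using True by (simp add: ge_one_powr_ge_zero)
      next
        case False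
        then have "?t \<le> 0" "s \<le> 1"
          using \<omega> s by (auto simp: deviant_def zero_le_mult_iff zero_less_mult_iff)
        then show ?thesis
          using s powr_mono' [of ?t 0 s] by simp
      qed
      also have "s powr ?t = (s powr (-q)) ^ n * s ^ visits n \<omega>"
        using s by (simp add: powr_realpow [symmetric] powr_powr powr_add [symmetric])
      finally show "\<omega> \<in> {\<omega> \<in> {0..<1}. 1 \<le> ennreal ((s powr (-q)) ^ n) * ennreal (s ^ visits n \<omega>)}"
        using \<omega> s by (simp add: deviant_def ennreal_mult [symmetric])
    qed
    then have "emeasure lborel (deviant q n) \<le>
        emeasure lborel {\<omega> \<in> {0..<1}. 1 \<le> ennreal ((s powr (-q)) ^ n) * ennreal (s ^ visits n \<omega>)}"
      by (intro emeasure_mono) auto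
    also have "\<dots> \<le> ennreal ((s powr (-q)) ^ n) *
        (\<integral>\<^sup>+\<omega>. ennreal (s ^ visits n \<omega>) * indicator {0..<1} \<omega> \<partial>lborel)"
      by (intro nn_integral_Markov_inequality) auto
    also have "\<dots> = ennreal (r ^ n)"
      using s pos by (simp add: nn_integral_power_visits r_def power_mult_distrib ennreal_mult)
    finally show ?thesis .
  qed
  moreover have "0 < r" "r < 1"
    using s pos by (auto simp: r_def powr_minus field_simps)
  ultimately show ?thesis
    using that by blast
qed

text \<open>The geometric bounds are summable, so the Borel-Cantelli lemma applies.\<close>

lemma AE_eventually_not_deviant:
  assumes "q \<noteq> p\<^sub>1"
  shows "AE \<omega> in lborel. \<forall>\<^sub>F n in sequentially. \<omega> \<notin> deviant q n"
proof -
  obtain r where r: "0 < r" "r < 1" and le: "\<And>n. emeasure lborel (deviant q n) \<le> ennreal (r ^ n)"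
    using emeasure_deviant_le [OF assms] by blast
  have "measure lborel (deviant q n) \<le> r ^ n" for n
    using le [of n] r by (simp add: measure_def enn2real_leI)
  then have "summable (\<lambda>n. measure lborel (deviant q n))"
    using r by (intro summable_comparison_test' [OF summable_geometric, of r]) auto
  moreover have "emeasure lborel (deviant q n) < \<infinity>" for n
    using le [of n] by (simp add: order_le_less_trans)
  ultimately show ?thesis
    using borel_cantelli_AE1 [of "deviant q" lborel] by auto
qed

lemma AE_visits_frequency:
  "AE \<omega> in lborel. \<omega> \<in> {0..<1} \<longrightarrow> (\<lambda>n. real (visits n \<omega>) / real n) \<longlonglongrightarrow> p\<^sub>1"
proof -
  \<comment> \<open>Only countably many thresholds, so that the exceptional null sets can be
    united.\<close>
  have "AE \<omega> in lborel. \<forall>k. (\<forall>\<^sub>F n in sequentially. \<omega> \<notin> deviant (p\<^sub>1 + 1 / Suc k) n) \<and>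
      (\<forall>\<^sub>F n in sequentially. \<omega> \<notin> deviant (p\<^sub>1 - 1 / Suc k) n)"
    unfolding AE_all_countable by (intro allI AE_conjI AE_eventually_not_deviant) auto
  then show ?thesis
  proof (eventually_elim, intro impI LIMSEQ_I)
    fix \<omega> e :: real
    assume *: "\<forall>k. (\<forall>\<^sub>F n in sequentially. \<omega> \<notin> deviant (p\<^sub>1 + 1 / Suc k) n) \<and>
      (\<forall>\<^sub>F n in sequentially. \<omega> \<notin> deviant (p\<^sub>1 - 1 / Suc k) n)"
      and "\<omega> \<in> {0..<1}" "0 < e"
    obtain k where k: "1 / real (Suc k) < e"
      using nat_approx_posE [OF \<open>0 < e\<close>] by auto
    have "\<forall>\<^sub>F n in sequentially. norm (real (visits n \<omega>) / real n - p\<^sub>1) < e"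
      using *[rule_format, of k, THEN conjunct1] *[rule_format, of k, THEN conjunct2]
        eventually_gt_at_top [of 0]
    proof eventually_elim
      case (elim n)
      then have "real (visits n \<omega>) < (p\<^sub>1 + 1 / Suc k) * real n"
        "(p\<^sub>1 - 1 / Suc k) * real n < real (visits n \<omega>)"
        using \<open>\<omega> \<in> {0..<1}\<close> by (auto simp: deviant_def zero_le_divide_iff zero_less_divide_iff not_le)
      then have "real (visits n \<omega>) / real n < p\<^sub>1 + 1 / Suc k"
        "p\<^sub>1 - 1 / Suc k < real (visits n \<omega>) / real n"
        using elim by (simp_all only: pos_divide_less_eq pos_less_divide_eq of_nat_0_less_iff)
      then show ?case
        using k by (simp only: real_norm_def abs_less_iff) linarith
    qed
    then show "\<exists>N. \<forall>n\<ge>N. norm (real (visits n \<omega>) / real n - p\<^sub>1) < e"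
      by (simp add: eventually_sequentially)
  qed
qed

section \<open>Pointwise limit of the scaled points\<close>

text \<open>Expresses the scaled point through \<open>z\<close>. The point with index
  \<open>Suc n\<close> results from \<open>n\<close> branches, hence \<open>y n\<close> over
  \<open>Suc n\<close>.\<close>

lemma scaled_pt_Suc:
  "scaled_pt \<alpha> \<beta> p\<^sub>1 p\<^sub>2 (Suc n) \<omega> = 1/2 * (y n \<omega> powr (-\<alpha>) / real (Suc n)) powr (-1/\<alpha>)"
proof -
  have "(y n \<omega> powr (-\<alpha>) / real (Suc n)) powr (-1/\<alpha>) = y n \<omega> / real (Suc n) powr (-1/\<alpha>)"
    using y_bounds [of n \<omega>] params by (simp only: powr_divide powr_powr) simp
  also have "\<dots> = y n \<omega> * real (Suc n) powr (1/\<alpha>)"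
    by (simp add: powr_minus divide_inverse)
  finally show ?thesis
    by (simp add: scaled_pt_def)
qed

text \<open>By \<open>y_powr_approx\<close>, \<open>z / n\<close> has the same limit as \<alpha>
  times the visit frequency; the rest is continuity of the power at a positive limit.\<close>

lemma scaled_pt_tendsto:
  assumes "(\<lambda>n. real (visits n \<omega>) / real n) \<longlonglongrightarrow> p\<^sub>1"
  shows "(\<lambda>n. scaled_pt \<alpha> \<beta> p\<^sub>1 p\<^sub>2 n \<omega>) \<longlonglongrightarrow> 1/2 * (\<alpha> * p\<^sub>1) powr (-1/\<alpha>)"
proof -
  let ?d = "\<lambda>n. (y n \<omega> powr (-\<alpha>) - \<alpha> * real (visits n \<omega>)) / real n"
  have "?d \<longlonglongrightarrow> 0"
  proof (rule LIMSEQ_I)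
    fix e :: real assume "0 < e"
    obtain M where M: "\<And>n. \<bar>y n \<omega> powr (-\<alpha>) - \<alpha> * real (visits n \<omega>)\<bar> \<le> M + e / 2 * real n"
      using y_powr_approx [OF half_gt_zero [OF \<open>0 < e\<close>]] by metis
    have "(\<lambda>n. M / real n) \<longlonglongrightarrow> 0"
      by (rule lim_const_over_n)
    then have "\<forall>\<^sub>F n in sequentially. M / real n < e / 2"
      using \<open>0 < e\<close> by (intro order_tendstoD(2)) auto
    then have "\<forall>\<^sub>F n in sequentially. norm (?d n) < e"
      using eventually_gt_at_top [of 0]
    proof eventually_elim
      case (elim n)
      have "norm (?d n) \<le> (M + e / 2 * real n) / real n"
        using M [of n] by (simp add: divide_right_mono)
      also have "\<dots> = M / real n + e / 2"
        using elim by (simp add: field_simps)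
      finally show ?case
        using elim(1) by linarith
    qed
    then show "\<exists>N. \<forall>n\<ge>N. norm (?d n - 0) < e"
      by (simp add: eventually_sequentially)
  qed
  \<comment> \<open>The factor \<open>n / Suc n\<close> changes the denominator to the one in
    \<open>scaled_pt_Suc\<close>.\<close>
  from tendsto_mult [OF tendsto_add [OF this tendsto_mult_left [OF assms, of \<alpha>]] LIMSEQ_n_over_Suc_n]
  have "(\<lambda>n. (?d n + \<alpha> * (real (visits n \<omega>) / real n)) * (real n / real (Suc n))) \<longlonglongrightarrow> \<alpha> * p\<^sub>1"
    by simp
  moreover have "\<forall>\<^sub>F n in sequentially. (?d n + \<alpha> * (real (visits n \<omega>) / real n)) * (real n / real (Suc n)) =
      y n \<omega> powr (-\<alpha>) / real (Suc n)"
    using eventually_gt_at_top [of 0] by eventually_elim (simp add: diff_divide_distrib)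
  ultimately have "(\<lambda>n. y n \<omega> powr (-\<alpha>) / real (Suc n)) \<longlonglongrightarrow> \<alpha> * p\<^sub>1"
    by (rule Lim_transform_eventually)
  then have "(\<lambda>n. 1/2 * (y n \<omega> powr (-\<alpha>) / real (Suc n)) powr (-1/\<alpha>)) \<longlonglongrightarrow> 1/2 * (\<alpha> * p\<^sub>1) powr (-1/\<alpha>)"
    using params by (intro tendsto_intros) auto
  then show ?thesis
    by (subst filterlim_sequentially_Suc [symmetric]) (simp only: scaled_pt_Suc)
qed

section \<open>Bounds for the scaled points\<close>

lemma scaled_pt_nonneg: "0 \<le> scaled_pt \<alpha> \<beta> p\<^sub>1 p\<^sub>2 (Suc n) \<omega>"
  and scaled_pt_le: "scaled_pt \<alpha> \<beta> p\<^sub>1 p\<^sub>2 (Suc n) \<omega> \<le> real (Suc n) powr (1/\<alpha>)"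
proof -
  have "rand_pt \<alpha> \<beta> p\<^sub>1 p\<^sub>2 (Suc n) \<omega> \<in> {0..1}"
    using y_bounds [of n \<omega>] by simp
  then show "0 \<le> scaled_pt \<alpha> \<beta> p\<^sub>1 p\<^sub>2 (Suc n) \<omega>"
    "scaled_pt \<alpha> \<beta> p\<^sub>1 p\<^sub>2 (Suc n) \<omega> \<le> real (Suc n) powr (1/\<alpha>)"
    unfolding scaled_pt_def atLeastAtMost_iff by (auto intro!: mult_left_le)
qed

lemma scaled_pt_bounded:
  obtains D where "\<forall>\<^sub>F n in sequentially. \<forall>\<omega>. p\<^sub>1 / 2 * real n \<le> real (visits n \<omega>) \<longrightarrow>
    scaled_pt \<alpha> \<beta> p\<^sub>1 p\<^sub>2 (Suc n) \<omega> \<le> D"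
proof -
  \<comment> \<open>The visits contribute at least \<open>4 * ?c * n\<close> to \<open>z\<close>.
    The error term takes \<open>2 * ?c * n\<close>, and for large \<open>n\<close> another
    \<open>?c * n\<close> absorbs \<open>M + ?c\<close>, which leaves
    \<open>?c * Suc n\<close>.\<close>
  let ?c = "\<alpha> * p\<^sub>1 / 8"
  have c: "0 < ?c"
    using params by simp
  obtain M where M: "\<And>n \<omega>. \<bar>y n \<omega> powr (-\<alpha>) - \<alpha> * real (visits n \<omega>)\<bar> \<le> M + 2 * ?c * real n"
    using y_powr_approx [of "2 * ?c"] c by auto
  have "\<forall>\<^sub>F n in sequentially. (M + ?c) / ?c \<le> real n"
    using filterlim_real_sequentially by (simp add: filterlim_at_top)
  then have "\<forall>\<^sub>F n in sequentially. \<forall>\<omega>. p\<^sub>1 / 2 * real n \<le> real (visits n \<omega>) \<longrightarrow>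
    scaled_pt \<alpha> \<beta> p\<^sub>1 p\<^sub>2 (Suc n) \<omega> \<le> 1/2 * ?c powr (-1/\<alpha>)"
  proof (eventually_elim, intro allI impI)
    fix n \<omega>
    assume n: "(M + ?c) / ?c \<le> real n" and v: "p\<^sub>1 / 2 * real n \<le> real (visits n \<omega>)"
    have "\<alpha> * (p\<^sub>1 / 2 * real n) \<le> \<alpha> * real (visits n \<omega>)"
      using v params by (intro mult_left_mono) auto
    moreover have "M + ?c \<le> ?c * real n"
      using n unfolding pos_divide_le_eq [OF c] by (simp only: mult.commute)
    ultimately have "?c * real (Suc n) \<le> y n \<omega> powr (-\<alpha>)"
      using M [of n \<omega>] by (simp add: algebra_simps)
    then have "?c \<le> y n \<omega> powr (-\<alpha>) / real (Suc n)"
      by (subst pos_le_divide_eq) auto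
    then have "(y n \<omega> powr (-\<alpha>) / real (Suc n)) powr (-1/\<alpha>) \<le> ?c powr (-1/\<alpha>)"
      using c params by (intro powr_mono2') auto
    then show "scaled_pt \<alpha> \<beta> p\<^sub>1 p\<^sub>2 (Suc n) \<omega> \<le> 1/2 * ?c powr (-1/\<alpha>)"
      unfolding scaled_pt_Suc by simp
  qed
  then show ?thesis
    by (rule that)
qed

section \<open>Convergence almost everywhere and in mean\<close>

lemma AE_scaled_pt_tendsto:
  "AE \<omega> in lebesgue_on {0..1}.
     (\<lambda>n. scaled_pt \<alpha> \<beta> p\<^sub>1 p\<^sub>2 n \<omega>) \<longlonglongrightarrow> 1/2 * (\<alpha> * p\<^sub>1) powr (-1/\<alpha>)"
proof (rule AE_lebesgue_on_unit_intervalI)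
  show "AE \<omega> in lborel. \<omega> \<in> {0..<1} \<longrightarrow>
      (\<lambda>n. scaled_pt \<alpha> \<beta> p\<^sub>1 p\<^sub>2 n \<omega>) \<longlonglongrightarrow> 1/2 * (\<alpha> * p\<^sub>1) powr (-1/\<alpha>)"
    using AE_visits_frequency by eventually_elim (blast intro: scaled_pt_tendsto)
qed

lemma measurable_scaled_pt_lebesgue_on [measurable]:
  "scaled_pt \<alpha> \<beta> p\<^sub>1 p\<^sub>2 (Suc n) \<in> borel_measurable (lebesgue_on S)"
  by (intro measurable_restrict_space1 measurable_completion) simp

lemma integrable_scaled_pt:
  "integrable (lebesgue_on {0..1}) (scaled_pt \<alpha> \<beta> p\<^sub>1 p\<^sub>2 (Suc n))"
  using scaled_pt_nonneg scaled_pt_le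
  by (intro finite_measure.integrable_const_bound [where B = "real (Suc n) powr (1/\<alpha>)"]
      finite_measure_lebesgue_on) auto

text \<open>The error is at most its truncation plus a polynomial in \<open>n\<close> (to a real
  power) supported on the bad set. Dominated convergence handles the truncation; the geometric
  measure bound beats the polynomial growth.\<close>

lemma scaled_pt_L1_tendsto:
  fixes c defines "c \<equiv> 1/2 * (\<alpha> * p\<^sub>1) powr (-1/\<alpha>)"
  shows "(\<lambda>n. \<integral>\<omega>. \<bar>scaled_pt \<alpha> \<beta> p\<^sub>1 p\<^sub>2 n \<omega> - c\<bar> \<partial>(lebesgue_on {0..1})) \<longlonglongrightarrow> 0"
proof -
  let ?M = "lebesgue_on {0..1::real}"
  interpret finite_measure ?M
    by (intro finite_measure_lebesgue_on) auto
  define f where "f n \<omega> = \<bar>scaled_pt \<alpha> \<beta> p\<^sub>1 p\<^sub>2 (Suc n) \<omega> - c\<bar>" for n \<omega>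
  define bad where "bad = deviant (p\<^sub>1 / 2)"
  have c: "0 \<le> c"
    by (simp add: c_def)
  have f: "integrable ?M (f n)" for n
    unfolding f_def using integrable_scaled_pt by simp
  obtain D where D: "\<forall>\<^sub>F n in sequentially. \<forall>\<omega>. p\<^sub>1 / 2 * real n \<le> real (visits n \<omega>) \<longrightarrow>
      scaled_pt \<alpha> \<beta> p\<^sub>1 p\<^sub>2 (Suc n) \<omega> \<le> D"
    using scaled_pt_bounded by blast
  \<comment> \<open>Bounds the error off the bad set for large \<open>n\<close>; the absolute value
    keeps it at least \<open>c\<close> whatever the sign of \<open>D\<close>.\<close>
  let ?B = "\<bar>D\<bar> + c"
  obtain r where r: "0 < r" "r < 1" and le: "\<And>n. emeasure lborel (bad n) \<le> ennreal (r ^ n)"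
    using emeasure_deviant_le [of "p\<^sub>1 / 2"] params unfolding bad_def by auto
  have bad_sets [measurable]: "bad n \<in> sets lebesgue" "bad n \<in> sets ?M" for n
    unfolding bad_def by (auto simp: sets_restrict_space deviant_def intro!: image_eqI [of _ _ "deviant (p\<^sub>1 / 2) n"])
  have "emeasure ?M (bad n) = emeasure lborel (bad n)" for n
    by (subst emeasure_restrict_space) (auto simp: bad_def deviant_def)
  then have bad_le: "measure ?M (bad n) \<le> r ^ n" for n
    using le [of n] r by (simp add: measure_def enn2real_leI)

  have "(\<lambda>n. \<integral>\<omega>. min (f n \<omega>) ?B \<partial>?M) \<longlonglongrightarrow> (\<integral>\<omega>. 0 \<partial>?M)"
  proof (rule integral_dominated_convergence [where w = "\<lambda>_. ?B"])
    show "AE \<omega> in ?M. (\<lambda>n. min (f n \<omega>) ?B) \<longlonglongrightarrow> 0"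
      using AE_scaled_pt_tendsto
    proof eventually_elim
      case (elim \<omega>)
      then have "(\<lambda>n. scaled_pt \<alpha> \<beta> p\<^sub>1 p\<^sub>2 (Suc n) \<omega>) \<longlonglongrightarrow> c"
        unfolding c_def by (rule LIMSEQ_Suc)
      then have "(\<lambda>n. f n \<omega>) \<longlonglongrightarrow> 0"
        unfolding f_def by (intro tendsto_rabs_zero) (simp add: LIM_zero_iff)
      from tendsto_min [OF this tendsto_const [of ?B]] show ?case
        using c by (simp add: min_def)
    qed
  qed (use c in \<open>auto simp: f_def\<close>)
  moreover have "(\<lambda>n. real (Suc n) powr (1/\<alpha>) * r ^ n) \<longlonglongrightarrow> 0"
    using r params by real_asymp
  ultimately have lim: "(\<lambda>n. (\<integral>\<omega>. min (f n \<omega>) ?B \<partial>?M) + real (Suc n) powr (1/\<alpha>) * r ^ n) \<longlonglongrightarrow> 0"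
    using tendsto_add_zero by simp
  have upper: "\<forall>\<^sub>F n in sequentially. (\<integral>\<omega>. f n \<omega> \<partial>?M) \<le>
      (\<integral>\<omega>. min (f n \<omega>) ?B \<partial>?M) + real (Suc n) powr (1/\<alpha>) * r ^ n"
    using D
  proof eventually_elim
    case (elim n)
    let ?a = "real (Suc n) powr (1/\<alpha>)"
    have int: "integrable ?M (\<lambda>\<omega>. min (f n \<omega>) ?B)" "integrable ?M (\<lambda>\<omega>. ?a * indicator (bad n) \<omega>)"
      using f by (auto intro!: integrable_mult_right simp: less_top [symmetric])
    have "AE \<omega> in ?M. f n \<omega> \<le> min (f n \<omega>) ?B + ?a * indicator (bad n) \<omega>"
    proof (intro AE_lebesgue_on_unit_intervalI AE_I2 impI)
      fix \<omega> :: real assume \<omega>: "\<omega> \<in> {0..<1}"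
      show "f n \<omega> \<le> min (f n \<omega>) ?B + ?a * indicator (bad n) \<omega>"
      proof (cases "\<omega> \<in> bad n")
        case True
        have "f n \<omega> \<le> ?a + c"
          using scaled_pt_nonneg [of n \<omega>] scaled_pt_le [of n \<omega>] c by (simp add: f_def abs_le_iff)
        moreover have "0 \<le> ?a"
          by simp
        \<comment> \<open>If the truncation is active it equals \<open>?B \<ge> c\<close>, which
          together with \<open>?a\<close> covers \<open>?a + c\<close>.\<close>
        ultimately show ?thesis
          using True c by (simp add: min_def) linarith
      next
        case False
        then have "p\<^sub>1 / 2 * real n \<le> real (visits n \<omega>)"
          using \<omega> params by (auto simp: bad_def deviant_def mult_le_0_iff)
        then have "scaled_pt \<alpha> \<beta> p\<^sub>1 p\<^sub>2 (Suc n) \<omega> \<le> D"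
          using elim by blast
        then have "f n \<omega> \<le> ?B"
          using scaled_pt_nonneg [of n \<omega>] c by (simp add: f_def abs_le_iff)
        then show ?thesis
          using False by simp
      qed
    qed
    then have "(\<integral>\<omega>. f n \<omega> \<partial>?M) \<le> (\<integral>\<omega>. min (f n \<omega>) ?B + ?a * indicator (bad n) \<omega> \<partial>?M)"
      using int f by (intro integral_mono_AE Bochner_Integration.integrable_add) auto
    also have "\<dots> = (\<integral>\<omega>. min (f n \<omega>) ?B \<partial>?M) + ?a * measure ?M (bad n)"
      using int bad_sets sets.sets_into_space [OF bad_sets(2), of n]
      by (subst Bochner_Integration.integral_add) (auto simp: Int_absorb2)
    also have "\<dots> \<le> (\<integral>\<omega>. min (f n \<omega>) ?B \<partial>?M) + ?a * r ^ n"
      using bad_le by (intro add_left_mono mult_left_mono) auto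
    finally show ?case .
  qed
  have "0 \<le> (\<integral>\<omega>. f n \<omega> \<partial>?M)" for n
    by (intro integral_nonneg_AE) (simp add: f_def)
  then have "(\<lambda>n. \<integral>\<omega>. f n \<omega> \<partial>?M) \<longlonglongrightarrow> 0"
    by (intro tendsto_sandwich [OF _ upper tendsto_const lim] always_eventually allI)
  then show ?thesis
    unfolding f_def by (rule LIMSEQ_imp_Suc)
qed

end

theorem theorem1p1:
  fixes \<alpha> \<beta> p\<^sub>1 p\<^sub>2 :: real
  assumes "0 < \<alpha>" and "\<alpha> < \<beta>" and "p\<^sub>1 > 0" and "p\<^sub>2 > 0" and "p\<^sub>1 + p\<^sub>2 = 1"
  shows "(AE \<omega> in lebesgue_on {0..1}.
            (\<lambda>n. scaled_pt \<alpha> \<beta> p\<^sub>1 p\<^sub>2 n \<omega>) \<longlonglongrightarrow> 1/2 * (\<alpha> * p\<^sub>1) powr (-1/\<alpha>) \<and>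
            (\<lambda>n. rand_pt \<alpha> \<beta> p\<^sub>1 p\<^sub>2 n \<omega>
                  / (asymp_const \<alpha> * p\<^sub>1 powr (-1/\<alpha>) * real n powr (-1/\<alpha>))) \<longlonglongrightarrow> 1)
       \<and> 1/2 * (\<alpha> * p\<^sub>1) powr (-1/\<alpha>) = asymp_const \<alpha> * p\<^sub>1 powr (-1/\<alpha>)
       \<and> (\<forall>n\<ge>1. integrable (lebesgue_on {0..1}) (scaled_pt \<alpha> \<beta> p\<^sub>1 p\<^sub>2 n))
       \<and> (\<lambda>n. \<integral>\<omega>. \<bar>scaled_pt \<alpha> \<beta> p\<^sub>1 p\<^sub>2 n \<omega> - asymp_const \<alpha> * p\<^sub>1 powr (-1/\<alpha>)\<bar>
               \<partial>(lebesgue_on {0..1})) \<longlonglongrightarrow> 0"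
proof -
  interpret random_lsv \<alpha> \<beta> p\<^sub>1 p\<^sub>2
    using assms by unfold_locales
  let ?c = "asymp_const \<alpha> * p\<^sub>1 powr (-1/\<alpha>)"
  have const: "1/2 * (\<alpha> * p\<^sub>1) powr (-1/\<alpha>) = ?c"
    using assms by (simp add: asymp_const_def powr_mult)
  have "?c \<noteq> 0"
    using assms by (simp add: asymp_const_def)
  \<comment> \<open>The quotient in the asymptotic equivalence is the scaled point over its limit,
    so its convergence to 1 follows by division.\<close>
  have quot: "rand_pt \<alpha> \<beta> p\<^sub>1 p\<^sub>2 n \<omega> / (?c * real n powr (-1/\<alpha>)) = scaled_pt \<alpha> \<beta> p\<^sub>1 p\<^sub>2 n \<omega> / ?c" for n \<omega>
    by (simp add: scaled_pt_def powr_minus divide_inverse)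
  have "AE \<omega> in lebesgue_on {0..1}. (\<lambda>n. scaled_pt \<alpha> \<beta> p\<^sub>1 p\<^sub>2 n \<omega>) \<longlonglongrightarrow> ?c \<and>
      (\<lambda>n. rand_pt \<alpha> \<beta> p\<^sub>1 p\<^sub>2 n \<omega> / (?c * real n powr (-1/\<alpha>))) \<longlonglongrightarrow> 1"
    using AE_scaled_pt_tendsto unfolding const
  proof eventually_elim
    case (elim \<omega>)
    then show ?case
      using tendsto_divide [OF elim tendsto_const \<open>?c \<noteq> 0\<close>] unfolding quot divide_self [OF \<open>?c \<noteq> 0\<close>]
      by blast
  qed
  moreover have "integrable (lebesgue_on {0..1}) (scaled_pt \<alpha> \<beta> p\<^sub>1 p\<^sub>2 n)" if "1 \<le> n" for n
    using integrable_scaled_pt [of "n - 1"] that by simp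
  ultimately show ?thesis
    using scaled_pt_L1_tendsto const by simp
qed

end
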